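(* Let $\mathcal{H}$ be a complex Hilbert space and let $A\in\mathcal{B}(\mathcal{H})$. Then for any $0\le t\le 1$, \[\sqrt2\left\|(1-t)\mathfrak{R}A+t\,\mathfrak{I}A\right\|\le\omega_t(A).\] In particular, $\frac{1}{\sqrt2}\left\|\mathfrak{R}A+\mathfrak{I}A\right\|\le\omega(A)$.
   Context: $\mathcal{B}(\mathcal{H})$ is the $C^*$-algebra of bounded linear operators on the complex Hilbert space $\mathcal{H}$, with operator norm $\|\cdot\|$. $\mathfrak{R}A=\frac{A+A^*}{2}$ and $\mathfrak{I}A=\frac{A-A^*}{2\mathrm{i}}$. The numerical radius is $\omega(A)=\sup_{\|x\|=1}|\langle Ax,x\rangle|$. For $0\le t\le 1$, the $t$-weighted numerical radius of $A$ is $\omega_t(A)=\omega\left((1-2t)A^*+A\right)$. *)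

theory Defs
  imports "HOL-Analysis.Analysis"
begin

text \<open>
  Complex inner product spaces. The ambient class already carries a real vector space
  structure and a norm; the axioms tie these to the complex scalar multiplication and to
  the inner product. The inner product is linear in its first argument.
\<close>

class complex_inner = real_normed_vector +
  fixes scaleC :: "complex \<Rightarrow> 'a \<Rightarrow> 'a" (infixr "*\<^sub>C" 75)
    and cinner :: "'a \<Rightarrow> 'a \<Rightarrow> complex"
  assumes scaleC_add_right: "c *\<^sub>C (x + y) = c *\<^sub>C x + c *\<^sub>C y"
    and scaleC_add_left: "(c + d) *\<^sub>C x = c *\<^sub>C x + d *\<^sub>C x"
    and scaleC_scaleC: "c *\<^sub>C d *\<^sub>C x = (c * d) *\<^sub>C x"
    and scaleC_one: "1 *\<^sub>C x = x"
    and scaleR_scaleC: "r *\<^sub>R x = complex_of_real r *\<^sub>C x"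
    and cinner_commute: "cinner x y = cnj (cinner y x)"
    and cinner_add_left: "cinner (x + y) z = cinner x z + cinner y z"
    and cinner_scaleC_left: "cinner (c *\<^sub>C x) y = c * cinner x y"
    and cinner_self: "cinner x x = complex_of_real ((norm x)\<^sup>2)"

class chilbert_space = complex_inner + complete_space

instantiation complex :: chilbert_space
begin

definition scaleC_complex :: "complex \<Rightarrow> complex \<Rightarrow> complex"
  where "scaleC_complex c z = c * z"

definition cinner_complex :: "complex \<Rightarrow> complex \<Rightarrow> complex"
  where "cinner_complex z w = z * cnj w"

instance
  by standard
    (simp_all add: scaleC_complex_def cinner_complex_def algebra_simps scaleR_conv_of_real
      complex_norm_square[symmetric])

end

definition bounded_clinear :: "('a::complex_inner \<Rightarrow> 'a) \<Rightarrow> bool"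
  where "bounded_clinear A \<longleftrightarrow> bounded_linear A \<and> (\<forall>c x. A (c *\<^sub>C x) = c *\<^sub>C A x)"

text \<open>
  For bounded complex-linear \<open>A\<close> on a Hilbert space, the vector described here exists and is
  unique by the Riesz representation theorem.
\<close>

definition cadjoint :: "('a::chilbert_space \<Rightarrow> 'a) \<Rightarrow> 'a \<Rightarrow> 'a"
  where "cadjoint A y = (THE z. \<forall>x. cinner (A x) y = cinner x z)"

definition re_op :: "('a::chilbert_space \<Rightarrow> 'a) \<Rightarrow> 'a \<Rightarrow> 'a"
  where "re_op A x = (1 / 2) *\<^sub>C (A x + cadjoint A x)"

definition im_op :: "('a::chilbert_space \<Rightarrow> 'a) \<Rightarrow> 'a \<Rightarrow> 'a"
  where "im_op A x = (1 / (2 * \<i>)) *\<^sub>C (A x - cadjoint A x)"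

text \<open>
  The supremum is taken in the nonnegative reals: inserting \<open>0\<close> changes nothing when unit
  vectors exist, and it gives the zero space numerical radius \<open>0\<close>, where otherwise the
  unspecified real number \<open>Sup {}\<close> would occur.
\<close>

definition numerical_radius :: "('a::chilbert_space \<Rightarrow> 'a) \<Rightarrow> real"
  where "numerical_radius A = Sup (insert 0 {cmod (cinner (A x) x) | x. norm x = 1})"

definition weighted_numerical_radius :: "real \<Rightarrow> ('a::chilbert_space \<Rightarrow> 'a) \<Rightarrow> real"
  where "weighted_numerical_radius t A =
    numerical_radius (\<lambda>x. (1 - 2 * t) *\<^sub>R cadjoint A x + A x)"

end

theory Submission
  imports Defs
begin

text \<open>
  Write \<open>A = R + \<i> I\<close> with \<open>R\<close>, \<open>I\<close> self-adjoint. Then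
  \<open>(1 - 2 t) A* + A = 2 ((1 - t) R + \<i> t I)\<close>, whose quadratic form at \<open>x\<close> is \<open>2 (a + \<i> b)\<close> with
  \<open>a = (1 - t) \<langle>R x, x\<rangle>\<close> and \<open>b = t \<langle>I x, x\<rangle>\<close> real. Since \<open>\<bar>a + b\<bar> \<le> sqrt 2 \<bar>a + \<i> b\<bar>\<close>, the quadratic form
  of the self-adjoint operator \<open>S = (1 - t) R + t I\<close> is bounded by the weighted numerical radius
  divided by \<open>sqrt 2\<close>, and the norm of a self-adjoint operator is controlled by its quadratic form.
  The second claim is the case \<open>t = 1/2\<close>.
\<close>

section \<open>Complex inner products\<close>

lemma cinner_add_right: "cinner x (y + z) = cinner x y + cinner x z"
  by (metis cinner_add_left cinner_commute complex_cnj_add)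

lemma cinner_scaleC_right: "cinner x (c *\<^sub>C y) = cnj c * cinner x y"
  by (metis cinner_commute cinner_scaleC_left complex_cnj_mult)

lemma cinner_scaleR_left: "cinner (r *\<^sub>R x) y = of_real r * cinner x y"
  by (simp add: scaleR_scaleC cinner_scaleC_left)

lemma cinner_scaleR_right: "cinner x (r *\<^sub>R y) = of_real r * cinner x y"
  by (simp add: scaleR_scaleC cinner_scaleC_right)

lemma cinner_minus_left: "cinner (- x) y = - cinner x y"
  using cinner_scaleR_left[of "-1" x y] by simp

lemma cinner_minus_right: "cinner x (- y) = - cinner x y"
  using cinner_scaleR_right[of x "-1" y] by simp

lemma cinner_diff_left: "cinner (x - y) z = cinner x z - cinner y z"
  using cinner_add_left[of x "- y" z] by (simp add: cinner_minus_left)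

lemma cinner_diff_right: "cinner x (y - z) = cinner x y - cinner x z"
  using cinner_add_right[of x y "- z"] by (simp add: cinner_minus_right)

lemma cinner_zero_right [simp]: "cinner x 0 = 0"
  using cinner_diff_right[of x 0 0] by simp

lemma Re_cinner_commute: "Re (cinner x y) = Re (cinner y x)"
  by (subst cinner_commute) simp

lemma norm_add_squared: "(norm (x + y))\<^sup>2 = (norm x)\<^sup>2 + 2 * Re (cinner x y) + (norm y)\<^sup>2"
  for x y :: "'a::complex_inner"
proof -
  have "Re (cinner (x + y) (x + y))
      = Re (cinner x x) + Re (cinner x y) + Re (cinner y x) + Re (cinner y y)"
    by (simp add: cinner_add_left cinner_add_right)
  then show ?thesis
    by (simp add: cinner_self Re_cinner_commute[of y x])
qed

lemma norm_diff_squared: "(norm (x - y))\<^sup>2 = (norm x)\<^sup>2 - 2 * Re (cinner x y) + (norm y)\<^sup>2"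
  for x y :: "'a::complex_inner"
  using norm_add_squared[of x "- y"] by (simp add: cinner_minus_right)

lemma cinner_Cauchy_Schwarz: "cmod (cinner x y) \<le> norm x * norm y"
proof (cases "y = 0")
  case False
  let ?c = "cinner x y" and ?n = "(norm y)\<^sup>2"
  \<comment> \<open>This is \<open>(norm y)\<^sup>2\<close> times the component of \<open>x\<close>
    orthogonal to \<open>y\<close>; the scaling avoids a division.\<close>
  define z where "z = ?n *\<^sub>R x - ?c *\<^sub>C y"
  have yx: "cinner y x = cnj ?c"
    by (rule cinner_commute)
  have "cinner z z
      = of_real ?n * (of_real ?n * of_real ((norm x)\<^sup>2)) - of_real ?n * (?c * cnj ?c)"
    by (simp add: z_def cinner_diff_left cinner_diff_right cinner_scaleR_left cinner_scaleR_right
        cinner_scaleC_left cinner_scaleC_right cinner_self[of x] cinner_self[of y] yx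
        algebra_simps power2_eq_square)
  also have "\<dots> = of_real (?n * (?n * (norm x)\<^sup>2 - (cmod ?c)\<^sup>2))"
    by (simp only: complex_norm_square[symmetric] of_real_mult of_real_diff right_diff_distrib)
  finally have "(norm z)\<^sup>2 = ?n * (?n * (norm x)\<^sup>2 - (cmod ?c)\<^sup>2)"
    unfolding cinner_self of_real_eq_iff .
  then have "0 \<le> ?n * (?n * (norm x)\<^sup>2 - (cmod ?c)\<^sup>2)"
    by (metis zero_le_power2)
  then have "(cmod ?c)\<^sup>2 \<le> (norm x * norm y)\<^sup>2"
    using False by (simp add: zero_le_mult_iff power_mult_distrib mult.commute)
  then show ?thesis
    by (rule power2_le_imp_le) simp
qed simp

lemma bounded_linear_cinner_left: "bounded_linear (\<lambda>x. cinner x y)"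
proof (rule bounded_linear_intro)
  show "norm (cinner x y) \<le> norm x * norm y" for x
    by (rule cinner_Cauchy_Schwarz)
qed (simp_all add: cinner_add_left cinner_scaleR_left scaleR_conv_of_real)

section \<open>The adjoint of a bounded operator\<close>

text \<open>
  The representing vector minimises \<open>z \<mapsto> \<parallel>z\<parallel>\<^sup>2 - 2 Re (f z)\<close>; minimising sequences are Cauchy by the
  parallelogram law.
\<close>

lemma Riesz_representation_Re:
  fixes g :: "'a::chilbert_space \<Rightarrow> real"
  assumes g: "bounded_linear g"
  obtains z where "\<And>x. g x = Re (cinner x z)"
proof -
  interpret g: bounded_linear g by (rule g)
  define J where "J = (\<lambda>z. (norm z)\<^sup>2 - 2 * g z)"
  define m where "m = Inf (range J)"
  obtain K where K: "\<And>x. norm (g x) \<le> norm x * K"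
    using g.bounded by blast
  \<comment> \<open>Completing the square: J z is at least (norm z - K)^2 - K^2.\<close>
  have "- K\<^sup>2 \<le> J z" for z
  proof -
    have "0 \<le> (norm z - K)\<^sup>2" by simp
    then show ?thesis
      using K[of z] by (simp add: J_def power2_diff abs_le_iff)
  qed
  then have bdd: "bdd_below (range J)"
    by (intro bdd_belowI[of _ "- K\<^sup>2"]) auto
  have m_le: "m \<le> J z" for z
    unfolding m_def using bdd by (simp add: cInf_lower)
  have "\<exists>u. J u < m + inverse (real (Suc n))" for n
  proof -
    have "Inf (range J) < m + inverse (real (Suc n))"
      by (simp add: m_def)
    then show ?thesis
      using bdd by (subst (asm) cInf_less_iff) auto
  qed
  then obtain u where u: "\<And>n. J (u n) < m + inverse (real (Suc n))"
    by metis
  \<comment> \<open>The midpoint of \<open>v\<close> and \<open>w\<close> has \<open>J\<close>-value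
    at least \<open>m\<close>, so two near-minimisers must be close.\<close>
  have parallelogram: "(norm (v - w))\<^sup>2 \<le> 2 * (J v - m) + 2 * (J w - m)" for v w
  proof -
    have "4 * J ((1/2) *\<^sub>R (v + w)) = (norm (v + w))\<^sup>2 - 4 * (g v + g w)"
      by (simp add: J_def g.scaleR g.add power_divide) (simp add: field_simps)
    then have "2 * (J v + J w) = 4 * J ((1/2) *\<^sub>R (v + w)) + (norm (v - w))\<^sup>2"
      by (simp add: J_def norm_add_squared norm_diff_squared)
    with m_le[of "(1/2) *\<^sub>R (v + w)"] show ?thesis by simp
  qed
  have "Cauchy u"
  proof (rule CauchyI)
    fix e :: real assume e: "0 < e"
    then have "0 < e\<^sup>2 / 4" by simp
    then obtain N where N: "inverse (real (Suc N)) < e\<^sup>2 / 4"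
      using reals_Archimedean by blast
    \<comment> \<open>The bound \<open>parallelogram\<close> doubles each of two errors, hence the
      quarter of \<open>e\<^sup>2\<close>.\<close>
    have small: "J (u n) - m < e\<^sup>2 / 4" if "n \<ge> N" for n
    proof -
      have "inverse (real (Suc n)) \<le> inverse (real (Suc N))"
        using that by (simp add: field_simps)
      then show ?thesis using u[of n] N by linarith
    qed
    have "norm (u i - u j) < e" if "i \<ge> N" "j \<ge> N" for i j
    proof -
      note parallelogram[of "u i" "u j"]
      also have "2 * (J (u i) - m) + 2 * (J (u j) - m) < 2 * (e\<^sup>2 / 4) + 2 * (e\<^sup>2 / 4)"
        by (intro add_strict_mono mult_strict_left_mono small that) simp_all
      also have "\<dots> = e\<^sup>2"
        by simp
      finally show ?thesis
        using e by (simp add: power2_less_imp_less)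
    qed
    then show "\<exists>M. \<forall>i\<ge>M. \<forall>j\<ge>M. norm (u i - u j) < e" by blast
  qed
  then obtain z where z: "u \<longlonglongrightarrow> z"
    using Cauchy_convergent_iff convergent_def by blast
  have "(\<lambda>n. J (u n)) \<longlonglongrightarrow> J z"
    unfolding J_def by (intro tendsto_intros g.tendsto z)
  moreover have "(\<lambda>n. m + inverse (real (Suc n))) \<longlonglongrightarrow> m"
    using tendsto_add[OF tendsto_const LIMSEQ_inverse_real_of_nat, of m] by simp
  ultimately have "J z \<le> m"
    by (rule LIMSEQ_le) (use u in \<open>auto intro: less_imp_le\<close>)
  have "g x = Re (cinner x z)" for x
  proof -
    let ?d = "Re (cinner z x) - g x"
    \<comment> \<open>First variation: the right-hand side is J (z + s x) - J z, and
      \<open>z\<close> is a minimiser.\<close>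
    have nonneg: "0 \<le> s * (2 * ?d) + s\<^sup>2 * (norm x)\<^sup>2" for s
    proof -
      have "J z \<le> J (z + s *\<^sub>R x)"
        using \<open>J z \<le> m\<close> m_le order_trans by blast
      then show ?thesis
        by (simp add: J_def norm_add_squared g.add g.scaleR cinner_scaleR_right
            power_mult_distrib algebra_simps)
    qed
    have "?d = 0"
    proof (cases "x = 0")
      case True
      then show ?thesis by (simp add: g.zero)
    next
      case False
      let ?N = "(norm x)\<^sup>2"
      \<comment> \<open>The parameter s = -d/N minimises the quadratic; the minimum -d^2/N can be
        nonnegative only if d = 0.\<close>
      have "0 \<le> (- ?d / ?N) * (2 * ?d) + (- ?d / ?N)\<^sup>2 * ?N"
        by (rule nonneg)
      also have "\<dots> = - (?d\<^sup>2 / ?N)"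
        using False by (simp add: field_simps power2_eq_square)
      finally show ?thesis
        using False by (simp add: divide_le_0_iff)
    qed
    then show ?thesis by (simp add: Re_cinner_commute)
  qed
  then show thesis by (rule that)
qed

text \<open>A complex-linear functional is determined by its real part, since Im (f x) = - Re (f (i
  x)).\<close>

lemma Riesz_representation:
  fixes f :: "'a::chilbert_space \<Rightarrow> complex"
  assumes "bounded_linear f" and hom: "\<And>c x. f (c *\<^sub>C x) = c * f x"
  obtains z where "\<And>x. f x = cinner x z"
proof -
  have "bounded_linear (\<lambda>x. Re (f x))"
    using bounded_linear_compose[OF bounded_linear_Re assms(1)] .
  then obtain z where z: "\<And>x. Re (f x) = Re (cinner x z)"
    by (rule Riesz_representation_Re) blast
  have "Im (f x) = Im (cinner x z)" for x
    using z[of "\<i> *\<^sub>C x"] by (simp add: hom cinner_scaleC_left)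
  with z have "f x = cinner x z" for x
    by (simp add: complex_eq_iff)
  then show thesis by (rule that)
qed

lemma cinner_right_unique:
  assumes "\<And>x. cinner x y = cinner x z"
  shows "y = z"
proof -
  have "cinner (y - z) (y - z) = 0"
    by (simp add: cinner_diff_right assms)
  then show ?thesis by (simp add: cinner_self)
qed

text \<open>This discharges the definite description in \<open>cadjoint\<close>: Riesz gives
  existence, \<open>cinner_right_unique\<close> uniqueness. All later facts about the adjoint rest
  on it.\<close>

lemma cinner_cadjoint_right:
  fixes A :: "'a::chilbert_space \<Rightarrow> 'a"
  assumes A: "bounded_clinear A"
  shows "cinner x (cadjoint A y) = cinner (A x) y"
proof -
  have "bounded_linear (\<lambda>x. cinner (A x) y)"
    using A bounded_linear_compose[OF bounded_linear_cinner_left]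
    unfolding bounded_clinear_def by blast
  moreover have "cinner (A (c *\<^sub>C x)) y = c * cinner (A x) y" for c x
    using A by (simp add: bounded_clinear_def cinner_scaleC_left)
  ultimately obtain z where z: "\<And>x. cinner (A x) y = cinner x z"
    by (rule Riesz_representation) blast
  have "cadjoint A y = z"
    unfolding cadjoint_def by (rule the_equality) (auto simp: z intro: cinner_right_unique)
  then show ?thesis by (simp add: z)
qed

lemma cinner_cadjoint_left:
  fixes A :: "'a::chilbert_space \<Rightarrow> 'a"
  assumes "bounded_clinear A"
  shows "cinner (cadjoint A x) y = cinner x (A y)"
  by (metis assms cinner_cadjoint_right cinner_commute)

lemma linear_cadjoint:
  fixes A :: "'a::chilbert_space \<Rightarrow> 'a"
  assumes "bounded_clinear A"
  shows "linear (cadjoint A)"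
  by (rule linearI; rule cinner_right_unique)
    (simp_all add: cinner_cadjoint_right[OF assms] cinner_add_right cinner_scaleR_right)

section \<open>Quadratic forms and the numerical radius\<close>

text \<open>Polarisation and the parallelogram law pass from the quadratic form to Re (cinner (S v)
  y); a \<open>y\<close> parallel to \<open>S x\<close> then recovers the norm.\<close>

lemma norm_le_of_symmetric_quadratic_form:
  fixes S :: "'a::complex_inner \<Rightarrow> 'a"
  assumes S: "linear S" and sym: "\<And>x y. cinner (S x) y = cinner x (S y)"
    and bound: "\<And>x. norm x = 1 \<Longrightarrow> \<bar>Re (cinner (S x) x)\<bar> \<le> w"
  shows "norm (S x) \<le> w * norm x"
proof (cases "S x = 0 \<or> x = 0")
  case True
  \<comment> \<open>The sign of \<open>w\<close> comes from evaluating \<open>bound\<close> at a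
    unit vector, which exists only if \<open>x\<close> is nonzero.\<close>
  have "0 \<le> w * norm x"
  proof (cases "x = 0")
    case False
    then have "0 \<le> w"
      using bound[of "x /\<^sub>R norm x"] by simp
    then show ?thesis by simp
  qed simp
  with True show ?thesis
    by (auto simp: linear_0[OF S])
next
  case False
  have q: "\<bar>Re (cinner (S v) v)\<bar> \<le> w * (norm v)\<^sup>2" for v
  proof (cases "v = 0")
    case False
    then show ?thesis
      using bound[of "v /\<^sub>R norm v"]
      by (simp add: linear_scale[OF S] cinner_scaleR_left cinner_scaleR_right abs_mult
          power2_eq_square field_simps)
  qed simp
  have polar: "2 * Re (cinner (S v) y) \<le> w * ((norm v)\<^sup>2 + (norm y)\<^sup>2)" for v y
  proof -
    have "Re (cinner (S y) v) = Re (cinner (S v) y)"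
      by (simp add: sym[of y v] Re_cinner_commute)
    then have "4 * Re (cinner (S v) y)
        = Re (cinner (S (v + y)) (v + y)) - Re (cinner (S (v - y)) (v - y))"
      by (simp add: linear_add[OF S] linear_diff[OF S] cinner_add_left cinner_add_right
          cinner_diff_left cinner_diff_right)
    also have "\<dots> \<le> w * (norm (v + y))\<^sup>2 + w * (norm (v - y))\<^sup>2"
      using q[of "v + y"] q[of "v - y"] by linarith
    also have "\<dots> = 2 * (w * ((norm v)\<^sup>2 + (norm y)\<^sup>2))"
      by (simp add: norm_add_squared norm_diff_squared algebra_simps)
    finally show ?thesis by simp
  qed
  \<comment> \<open>The length of \<open>y\<close> is that of \<open>x\<close>, so that both squares
    in \<open>polar\<close> coincide and one factor \<open>norm x\<close> cancels.\<close>
  define y where "y = (norm x / norm (S x)) *\<^sub>R S x"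
  have "norm y = norm x"
    using False by (simp add: y_def)
  moreover have "Re (cinner (S x) y) = norm x * norm (S x)"
    using False by (simp add: y_def cinner_scaleR_right cinner_self power2_eq_square)
  ultimately have "norm x * norm (S x) \<le> norm x * (w * norm x)"
    using polar[of x y] by (simp add: power2_eq_square mult.left_commute)
  then show ?thesis
    using False by simp
qed

text \<open>The constant \<open>K\<close> only makes the set bounded above, so that its supremum is
  a genuine upper bound; the inserted 0 gives nonnegativity even without unit vectors.\<close>

lemma
  fixes T :: "'a::chilbert_space \<Rightarrow> 'a"
  assumes "\<And>x. norm x = 1 \<Longrightarrow> cmod (cinner (T x) x) \<le> K"
  shows cmod_cinner_le_numerical_radius:
      "norm x = 1 \<Longrightarrow> cmod (cinner (T x) x) \<le> numerical_radius T"
    and numerical_radius_nonneg: "0 \<le> numerical_radius T"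
proof -
  have "bdd_above (insert 0 {cmod (cinner (T x) x) | x. norm x = 1})"
    using assms by (auto intro!: bdd_aboveI[of _ K])
  then show "norm x = 1 \<Longrightarrow> cmod (cinner (T x) x) \<le> numerical_radius T"
    and "0 \<le> numerical_radius T"
    unfolding numerical_radius_def by (auto intro!: cSup_upper)
qed

text \<open>The source of the factor \<open>sqrt 2\<close>: the inequality amounts to (Re z - Im
  z)^2 being nonnegative.\<close>

lemma abs_add_le_sqrt2_cmod: "\<bar>Re z + Im z\<bar> \<le> sqrt 2 * cmod z"
proof -
  have "(Re z + Im z)\<^sup>2 \<le> 2 * ((Re z)\<^sup>2 + (Im z)\<^sup>2)"
    using zero_le_power2[of "Re z - Im z"] by (simp add: power2_sum power2_diff)
  then have "sqrt ((Re z + Im z)\<^sup>2) \<le> sqrt (2 * ((Re z)\<^sup>2 + (Im z)\<^sup>2))"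
    by (rule real_sqrt_le_mono)
  then show ?thesis
    by (simp only: real_sqrt_mult cmod_def real_sqrt_abs)
qed

section \<open>Real and imaginary parts of an operator\<close>

lemma cinner_re_op:
  assumes "bounded_clinear A"
  shows "cinner (re_op A x) y = (cinner (A x) y + cinner x (A y)) / 2"
  by (simp add: re_op_def cinner_scaleC_left cinner_add_left cinner_cadjoint_left[OF assms])

lemma cinner_im_op:
  assumes "bounded_clinear A"
  shows "cinner (im_op A x) y = (cinner (A x) y - cinner x (A y)) / (2 * \<i>)"
  by (simp add: im_op_def cinner_scaleC_left cinner_diff_left cinner_cadjoint_left[OF assms])

lemma scaleC_scaleR: "c *\<^sub>C r *\<^sub>R x = r *\<^sub>R c *\<^sub>C x"
  by (simp add: scaleR_scaleC scaleC_scaleC mult.commute)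

lemma scaleC_diff_right: "c *\<^sub>C (x - y) = c *\<^sub>C x - c *\<^sub>C y"
  using scaleC_add_right[of c "x - y" y] by (simp add: algebra_simps)

lemma linear_re_op:
  assumes "bounded_clinear A"
  shows "linear (re_op A)"
proof -
  have "linear A"
    using assms by (simp add: bounded_clinear_def bounded_linear.linear)
  with linear_cadjoint[OF assms] show ?thesis
    by (intro linearI) (simp_all add: re_op_def linear_add linear_scale scaleC_add_right
        scaleC_scaleR scaleR_add_right)
qed

lemma linear_im_op:
  assumes "bounded_clinear A"
  shows "linear (im_op A)"
proof -
  have "linear A"
    using assms by (simp add: bounded_clinear_def bounded_linear.linear)
  with linear_cadjoint[OF assms] show ?thesis
    by (intro linearI) (simp_all add: im_op_def linear_add linear_scale scaleC_add_right
        scaleC_diff_right scaleC_scaleR scaleR_diff_right)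
qed

text \<open>The pointwise bound and the sign condition are the two premises that
  \<open>onorm_bound\<close> requires.\<close>

lemma norm_weighted_parts_le:
  fixes A :: "'a::chilbert_space \<Rightarrow> 'a"
  assumes A: "bounded_clinear A"
  shows "norm ((1 - t) *\<^sub>R re_op A x + t *\<^sub>R im_op A x)
    \<le> weighted_numerical_radius t A / sqrt 2 * norm x"
    and "0 \<le> weighted_numerical_radius t A"
proof -
  define T where "T = (\<lambda>x. (1 - 2 * t) *\<^sub>R cadjoint A x + A x)"
  define S where "S = (\<lambda>x. (1 - t) *\<^sub>R re_op A x + t *\<^sub>R im_op A x)"
  have w: "weighted_numerical_radius t A = numerical_radius T"
    by (simp add: weighted_numerical_radius_def T_def)
  have T: "cinner (T v) v = of_real (1 - 2 * t) * cnj (cinner (A v) v) + cinner (A v) v" for v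
    by (simp add: T_def cinner_add_left cinner_scaleR_left cinner_cadjoint_left[OF A]
        cinner_commute[of v "A v"])
  have S: "cinner (S v) y = of_real (1 - t) * ((cinner (A v) y + cinner v (A y)) / 2)
      + of_real t * ((cinner (A v) y - cinner v (A y)) / (2 * \<i>))" for v y
    by (simp add: S_def cinner_add_left cinner_scaleR_left cinner_re_op[OF A] cinner_im_op[OF A])
  obtain K where K: "\<And>v. norm (A v) \<le> norm v * K"
    using A bounded_linear.bounded unfolding bounded_clinear_def by blast
  \<comment> \<open>A crude bound, used only to make the supremum in
    \<open>numerical_radius T\<close> meaningful.\<close>
  have T_bounded: "cmod (cinner (T v) v) \<le> \<bar>1 - 2 * t\<bar> * K + K" if "norm v = 1" for v
  proof -
    have AK: "cmod (cinner (A v) v) \<le> K"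
      using cinner_Cauchy_Schwarz[of "A v" v] K[of v] that by simp
    have "cmod (cinner (T v) v) \<le> \<bar>1 - 2 * t\<bar> * cmod (cinner (A v) v) + cmod (cinner (A v) v)"
      unfolding T by (rule norm_triangle_le) (simp add: norm_mult del: of_real_diff)
    also have "\<dots> \<le> \<bar>1 - 2 * t\<bar> * K + K"
      by (intro add_mono mult_left_mono AK) simp
    finally show ?thesis .
  qed
  have "linear S"
    unfolding S_def
    by (intro linear_compose_add linear_compose_scale_right linear_re_op linear_im_op A)
  \<comment> \<open>In the \<open>im_op\<close> term, exchanging the arguments flips the sign of the
    difference and conjugation flips that of 2i; the two signs cancel.\<close>
  moreover have "cinner (S v) y = cinner v (S y)" for v y
    unfolding cinner_commute[of v "S y"] S
    by (simp add: cinner_commute[of y "A v"] cinner_commute[of "A y" v] field_simps)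
  moreover have "\<bar>Re (cinner (S v) v)\<bar> \<le> numerical_radius T / sqrt 2" if "norm v = 1" for v
  proof -
    \<comment> \<open>With cinner (A v) v = a + ib, the form of \<open>T\<close> is 2 ((1 - t) a + i
      t b) and that of \<open>S\<close> is (1 - t) a + t b.\<close>
    have "2 * Re (cinner (S v) v) = Re (cinner (T v) v) + Im (cinner (T v) v)"
      unfolding S T cinner_commute[of v "A v"]
      by (simp add: Re_divide Im_divide field_simps)
    then have "2 * \<bar>Re (cinner (S v) v)\<bar> \<le> sqrt 2 * cmod (cinner (T v) v)"
      using abs_add_le_sqrt2_cmod[of "cinner (T v) v"] by simp
    also have "\<dots> \<le> sqrt 2 * numerical_radius T"
      using cmod_cinner_le_numerical_radius[OF T_bounded that] by simp
    finally have "2 * \<bar>Re (cinner (S v) v)\<bar> / 2 \<le> sqrt 2 * numerical_radius T / 2"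
      by (intro divide_right_mono) simp_all
    also have "sqrt 2 * numerical_radius T / 2 = numerical_radius T / sqrt 2"
      by (simp add: field_simps)
    finally show ?thesis by simp
  qed
  ultimately have "norm (S x) \<le> numerical_radius T / sqrt 2 * norm x"
    by (rule norm_le_of_symmetric_quadratic_form)
  then show "norm ((1 - t) *\<^sub>R re_op A x + t *\<^sub>R im_op A x)
    \<le> weighted_numerical_radius t A / sqrt 2 * norm x"
    by (simp add: w S_def)
  show "0 \<le> weighted_numerical_radius t A"
    unfolding w by (rule numerical_radius_nonneg[OF T_bounded])
qed

theorem proposition2p4:
  fixes A :: "'a::chilbert_space \<Rightarrow> 'a"
  assumes "bounded_clinear A"
  shows "(\<forall>t::real. 0 \<le> t \<and> t \<le> 1 \<longrightarrow>
            sqrt 2 * onorm (\<lambda>x. (1 - t) *\<^sub>R re_op A x + t *\<^sub>R im_op A x)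
              \<le> weighted_numerical_radius t A) \<and>
         1 / sqrt 2 * onorm (\<lambda>x. re_op A x + im_op A x) \<le> numerical_radius A"
proof (intro conjI allI impI)
  fix t :: real
  have "onorm (\<lambda>x. (1 - t) *\<^sub>R re_op A x + t *\<^sub>R im_op A x) \<le> weighted_numerical_radius t A / sqrt 2"
    by (intro onorm_bound norm_weighted_parts_le assms divide_nonneg_nonneg) simp
  then show "sqrt 2 * onorm (\<lambda>x. (1 - t) *\<^sub>R re_op A x + t *\<^sub>R im_op A x)
      \<le> weighted_numerical_radius t A"
    by (simp add: field_simps)
next
  \<comment> \<open>At t = 1/2 the adjoint term has coefficient 0.\<close>
  have w: "weighted_numerical_radius (1/2) A = numerical_radius A"
    by (simp add: weighted_numerical_radius_def)
  have "norm (re_op A x + im_op A x) \<le> sqrt 2 * numerical_radius A * norm x" for x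
  proof -
    \<comment> \<open>Both weights equal 1/2 here and are pulled out of the norm.\<close>
    have "norm (re_op A x + im_op A x) / 2 \<le> numerical_radius A / sqrt 2 * norm x"
      using norm_weighted_parts_le(1)[OF assms, of "1/2" x]
      by (simp add: w flip: scaleR_add_right)
    also have "\<dots> = sqrt 2 * numerical_radius A * norm x / 2"
      by (simp add: field_simps)
    finally show ?thesis by simp
  qed
  moreover have "0 \<le> sqrt 2 * numerical_radius A"
    using norm_weighted_parts_le(2)[OF assms, of "1/2"] by (simp add: w)
  ultimately have "onorm (\<lambda>x. re_op A x + im_op A x) \<le> sqrt 2 * numerical_radius A"
    by (intro onorm_bound)
  then show "1 / sqrt 2 * onorm (\<lambda>x. re_op A x + im_op A x) \<le> numerical_radius A"
    by (simp add: field_simps)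
qed

end
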